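(* Let $X$ be a real vector space, let $\Omega\subset X$ be a convex set with $\mathrm{core}(\Omega)\neq\emptyset$, and let $x_0\in X$ with $x_0\notin\Omega$. Then $\Omega$ and $\{x_0\}$ are properly separated by a hyperplane. Moreover, in the case where $\Omega=\mathrm{core}(\Omega)$, there is a nonzero linear function $f\colon X\to\mathbb{R}$ such that $$f(x)<f(x_0)\quad\text{for all }x\in\Omega.$$
   Context: All vector spaces are real and carry no topology. For a nonempty set $\Omega\subset X$, the algebraic core is $\mathrm{core}(\Omega):=\{x\in\Omega\mid \forall v\in X\ \exists\delta>0\ \forall t\in\mathbb{R}\text{ with }|t|<\delta:\ x+tv\in\Omega\}$. Two nonempty sets $\Omega_1,\Omega_2\subset X$ are separated (by a hyperplane) if there is a nonzero linear function $f\colon X\to\mathbb{R}$ with $\sup\{f(x)\mid x\in\Omega_1\}\le\inf\{f(x)\mid x\in\Omega_2\}$. They are properly separated if, in addition, the same $f$ satisfies $\inf\{f(x)\mid x\in\Omega_1\}<\sup\{f(x)\mid x\in\Omega_2\}$, i.e., there are $x_1\in\Omega_1$, $x_2\in\Omega_2$ with $f(x_1)<f(x_2)$. *)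

theory Defs
  imports "HOL-Analysis.Convex" "HOL-Library.Extended_Real"
begin

definition algebraic_core :: "'a::real_vector set \<Rightarrow> 'a set" where
  "algebraic_core \<Omega> =
     {x \<in> \<Omega>. \<forall>v. \<exists>\<delta>>0. \<forall>t::real. \<bar>t\<bar> < \<delta> \<longrightarrow> x + t *\<^sub>R v \<in> \<Omega>}"

(* Suprema and infima are taken in the extended reals, since f may be unbounded
   on either set; the real-valued Sup and Inf are unspecified in that case. *)

definition separates :: "('a::real_vector \<Rightarrow> real) \<Rightarrow> 'a set \<Rightarrow> 'a set \<Rightarrow> bool" where
  "separates f \<Omega>1 \<Omega>2 \<longleftrightarrow>
     linear f \<and> f \<noteq> (\<lambda>x. 0) \<and>
     (SUP x\<in>\<Omega>1. ereal (f x)) \<le> (INF x\<in>\<Omega>2. ereal (f x))"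

definition properly_separated :: "'a::real_vector set \<Rightarrow> 'a set \<Rightarrow> bool" where
  "properly_separated \<Omega>1 \<Omega>2 \<longleftrightarrow>
     \<Omega>1 \<noteq> {} \<and> \<Omega>2 \<noteq> {} \<and>
     (\<exists>f. separates f \<Omega>1 \<Omega>2 \<and>
          (INF x\<in>\<Omega>1. ereal (f x)) < (SUP x\<in>\<Omega>2. ereal (f x)))"

end

theory Submission imports Defs begin

text \<open>The set \<open>\<Omega> - x\<^sub>0\<close> generates a convex cone that omits the origin. By Zorn's lemma it lies in a
  maximal such cone \<open>C\<close>, and maximality makes \<open>C\<close> the positive cone of a total vector space ordering.
  For a core point \<open>a\<close> of \<open>\<Omega>\<close>, the vector \<open>e = a - x\<^sub>0\<close> is an order unit, so every vector \<open>v\<close>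
  determines a Dedekind cut of the real line by comparing \<open>v\<close> with the multiples of \<open>e\<close>; the cut
  value depends linearly on \<open>v\<close>, and it is nonnegative on \<open>C\<close>.\<close>

section \<open>Blunt convex cones and their extension to total ones\<close>

definition blunt_cone :: "'a::real_vector set \<Rightarrow> bool" where
  "blunt_cone C \<longleftrightarrow> 0 \<notin> C \<and> (\<forall>x\<in>C. \<forall>y\<in>C. x + y \<in> C) \<and> (\<forall>x\<in>C. \<forall>c>0. c *\<^sub>R x \<in> C)"

lemma blunt_coneD:
  assumes "blunt_cone C"
  shows "0 \<notin> C" and "x \<in> C \<Longrightarrow> y \<in> C \<Longrightarrow> x + y \<in> C"
    and "x \<in> C \<Longrightarrow> 0 < c \<Longrightarrow> c *\<^sub>R x \<in> C"
  using assms by (auto simp: blunt_cone_def)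

lemma blunt_cone_Union_chain:
  assumes "subset.chain {C. blunt_cone C} \<C>"
  shows "blunt_cone (\<Union>\<C>)"
proof -
  have cone: "blunt_cone C" if "C \<in> \<C>" for C
    using assms that by (auto simp: subset.chain_def)
  have "x + y \<in> \<Union>\<C>" if "x \<in> \<Union>\<C>" "y \<in> \<Union>\<C>" for x y
  proof -
    from that obtain A B where AB: "x \<in> A" "A \<in> \<C>" "y \<in> B" "B \<in> \<C>" by blast
    then have "A \<subseteq> B \<or> B \<subseteq> A"
      using assms by (metis subset_chain_def)
    then show ?thesis
      using AB cone blunt_coneD(2) by blast
  qed
  moreover have "c *\<^sub>R x \<in> \<Union>\<C>" if "x \<in> \<Union>\<C>" "c > 0" for x c
    using that cone blunt_coneD(3) by blast
  moreover have "0 \<notin> \<Union>\<C>"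
    using cone blunt_coneD(1) by blast
  ultimately show ?thesis
    by (auto simp: blunt_cone_def)
qed

text \<open>Sums within \<open>C\<close> or within \<open>D\<close> stay there because each is a
  cone; the third assumption says that \<open>D\<close> absorbs the mixed sums.\<close>

lemma blunt_cone_Un:
  assumes C: "blunt_cone C" and D: "blunt_cone D"
    and "\<And>x y. x \<in> C \<Longrightarrow> y \<in> D \<Longrightarrow> x + y \<in> D"
  shows "blunt_cone (C \<union> D)"
proof -
  have "x + y \<in> C \<union> D" if "x \<in> C \<union> D" "y \<in> C \<union> D" for x y
    using that assms(3)[of x y] assms(3)[of y x] blunt_coneD(2)[OF C, of x y]
      blunt_coneD(2)[OF D, of x y] by (auto simp: add.commute)
  then show ?thesis
    using blunt_coneD(1,3)[OF C] blunt_coneD(1,3)[OF D] unfolding blunt_cone_def by blast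
qed

text \<open>A relation \<open>x + t *\<^sub>R v = 0\<close> would make \<open>- v\<close> a positive
  multiple of \<open>x\<close>, hence put it in \<open>C\<close>, or force \<open>v = 0\<close> when
  \<open>x = 0\<close>. Since \<open>C\<close> omits the origin, \<open>insert 0 C\<close> is what
  brings the open ray through \<open>v\<close> itself into the new cone.\<close>

lemma blunt_cone_adjoin:
  assumes C: "blunt_cone C" and v: "v \<noteq> 0" "- v \<notin> C"
  shows "blunt_cone (C \<union> {x + t *\<^sub>R v | x t. x \<in> insert 0 C \<and> 0 < t})" (is "blunt_cone (C \<union> ?D)")
proof -
  note [simp] = blunt_coneD[OF C]
  have "0 \<notin> ?D"
  proof
    assume "0 \<in> ?D"
    then obtain x t where *: "x \<in> insert 0 C" "t > 0" "x + t *\<^sub>R v = 0" by auto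
    then have "- v = (1 / t) *\<^sub>R x"
      by (simp add: add_eq_0_iff2 scaleR_minus_right)
    then show False
      using * v by auto
  qed
  moreover have "x + y \<in> ?D" if "x \<in> ?D" "y \<in> ?D" for x y
  proof -
    from that obtain w s z t where *: "w \<in> insert 0 C" "s > 0" "x = w + s *\<^sub>R v"
      "z \<in> insert 0 C" "t > 0" "y = z + t *\<^sub>R v" by auto
    then have "x + y = (w + z) + (s + t) *\<^sub>R v" "w + z \<in> insert 0 C" "s + t > 0"
      by (auto simp: algebra_simps)
    then show ?thesis
      by blast
  qed
  moreover have "c *\<^sub>R x \<in> ?D" if "x \<in> ?D" "c > 0" for x c
  proof -
    from that obtain z t where *: "z \<in> insert 0 C" "t > 0" "x = z + t *\<^sub>R v" by auto
    then have "c *\<^sub>R x = c *\<^sub>R z + (c * t) *\<^sub>R v" "c *\<^sub>R z \<in> insert 0 C" "c * t > 0"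
      using that by (auto simp: scaleR_add_right)
    then show ?thesis
      by blast
  qed
  ultimately have "blunt_cone ?D"
    by (simp only: blunt_cone_def) blast
  moreover have "x + y \<in> ?D" if "x \<in> C" "y \<in> ?D" for x y
  proof -
    from that obtain z t where *: "z \<in> insert 0 C" "t > 0" "y = z + t *\<^sub>R v" by auto
    then have "x + y = (x + z) + t *\<^sub>R v" "x + z \<in> C"
      using that by (auto simp: add.assoc)
    then show ?thesis
      using * by blast
  qed
  ultimately show ?thesis
    by (intro blunt_cone_Un C)
qed

text \<open>Zorn's lemma gives a maximal blunt cone above \<open>K\<close>. If it missed both
  \<open>v\<close> and \<open>- v\<close>, adjoining \<open>v\<close> would enlarge it.\<close>

lemma blunt_cone_extend_total:
  assumes "blunt_cone K"
  obtains C where "blunt_cone C" "K \<subseteq> C" "\<And>v. v \<noteq> 0 \<Longrightarrow> v \<in> C \<or> - v \<in> C"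
proof -
  let ?A = "{C. blunt_cone C \<and> K \<subseteq> C}"
  have "\<exists>M\<in>?A. \<forall>X\<in>?A. M \<subseteq> X \<longrightarrow> X = M"
  proof (rule subset_Zorn_nonempty)
    show "?A \<noteq> {}"
      using assms by blast
    fix \<C> assume "\<C> \<noteq> {}" and chain: "subset.chain ?A \<C>"
    then have "subset.chain {C. blunt_cone C} \<C>"
      by (auto simp: subset.chain_def)
    then have "blunt_cone (\<Union>\<C>)"
      by (rule blunt_cone_Union_chain)
    \<comment> \<open>The union contains \<open>K\<close> because the chain has at least one member,
      and every member contains \<open>K\<close>.\<close>
    moreover have "K \<subseteq> C" if "C \<in> \<C>" for C
      using chain that by (auto simp: subset.chain_def)
    ultimately show "\<Union>\<C> \<in> ?A"
      using \<open>\<C> \<noteq> {}\<close> by blast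
  qed
  then obtain C where "C \<in> ?A" and max: "\<forall>X\<in>?A. C \<subseteq> X \<longrightarrow> X = C"
    by (rule bexE)
  then have C: "blunt_cone C" "K \<subseteq> C"
    by simp_all
  have maximal: "X = C" if "blunt_cone X" "C \<subseteq> X" for X
    using max C(2) that by simp
  have "v \<in> C \<or> - v \<in> C" if "v \<noteq> 0" for v
  proof (rule ccontr)
    assume *: "\<not> (v \<in> C \<or> - v \<in> C)"
    let ?D = "{x + t *\<^sub>R v | x t. x \<in> insert 0 C \<and> 0 < t}"
    have "C \<union> ?D = C"
      using * that by (intro maximal blunt_cone_adjoin C) auto
    moreover have "0 + 1 *\<^sub>R v \<in> ?D"
      by (intro CollectI exI[of _ 0] exI[of _ 1]) simp
    ultimately have "v \<in> C"
      by auto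
    with * show False by blast
  qed
  with C show ?thesis
    by (rule that)
qed

text \<open>Convexity gives closure under sums: two generators with factors \<open>s\<close> and
  \<open>t\<close> add up to \<open>s + t\<close> times the generator of the average of their points
  with weights \<open>s / (s + t)\<close> and \<open>t / (s + t)\<close>. The origin is omitted
  because the factors are positive and \<open>x\<^sub>0\<close> lies outside the set.\<close>

lemma blunt_cone_convex_translate:
  assumes "convex \<Omega>" "x\<^sub>0 \<notin> \<Omega>"
  shows "blunt_cone {t *\<^sub>R (x - x\<^sub>0) | t x. 0 < t \<and> x \<in> \<Omega>}" (is "blunt_cone ?K")
proof -
  have "y + z \<in> ?K" if "y \<in> ?K" "z \<in> ?K" for y z
  proof -
    from that obtain s x t w where *: "s > 0" "x \<in> \<Omega>" "y = s *\<^sub>R (x - x\<^sub>0)"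
      "t > 0" "w \<in> \<Omega>" "z = t *\<^sub>R (w - x\<^sub>0)" by blast
    let ?u = "(s / (s + t)) *\<^sub>R x + (t / (s + t)) *\<^sub>R w"
    have "s / (s + t) + t / (s + t) = 1"
      using * by (simp add: add_divide_distrib[symmetric])
    then have "?u \<in> \<Omega>"
      using * by (intro convexD[OF assms(1)]) auto
    moreover have "(s + t) *\<^sub>R ?u = s *\<^sub>R x + t *\<^sub>R w"
      using * by (simp add: scaleR_add_right)
    then have "y + z = (s + t) *\<^sub>R (?u - x\<^sub>0)"
      using * by (simp add: scaleR_diff_right scaleR_add_left)
    ultimately show ?thesis
      using * by (intro CollectI exI[of _ "s + t"] exI[of _ ?u]) auto
  qed
  moreover have "c *\<^sub>R y \<in> ?K" if "y \<in> ?K" "c > 0" for y c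
  proof -
    from that obtain t x where *: "t > 0" "x \<in> \<Omega>" "y = t *\<^sub>R (x - x\<^sub>0)" by blast
    then show ?thesis
      using \<open>c > 0\<close> by (intro CollectI exI[of _ "c * t"] exI[of _ x]) auto
  qed
  moreover have "0 \<notin> ?K"
    using assms(2) by auto
  ultimately show ?thesis
    by (simp add: blunt_cone_def)
qed

section \<open>Dedekind cuts along an order unit\<close>

text \<open>With \<open>C\<close> as the strictly positive vectors, this places \<open>v\<close>
  above all multiples of \<open>e\<close> with factor below \<open>r\<close> and below all those
  with factor above \<open>r\<close>. Nothing is fixed at \<open>s = r\<close>: the difference there
  may be zero, or an infinitesimal of either sign relative to \<open>e\<close>.\<close>

definition vector_cut :: "'a::real_vector set \<Rightarrow> 'a \<Rightarrow> 'a \<Rightarrow> real \<Rightarrow> bool" where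
  "vector_cut C e v r \<longleftrightarrow> (\<forall>s<r. v - s *\<^sub>R e \<in> C) \<and> (\<forall>s>r. s *\<^sub>R e - v \<in> C)"

text \<open>A number \<open>s\<close> strictly between two cut values would put both
  \<open>v - s *\<^sub>R e\<close> and its negative into \<open>C\<close>, and their sum is the
  omitted origin.\<close>

lemma vector_cut_unique:
  assumes C: "blunt_cone C" and "vector_cut C e v r" "vector_cut C e v r'"
  shows "r = r'"
proof -
  have *: False if "p < q" "vector_cut C e v p" "vector_cut C e v q" for p q
  proof -
    obtain s where "p < s" "s < q"
      using \<open>p < q\<close> dense by blast
    then have "v - s *\<^sub>R e \<in> C" "s *\<^sub>R e - v \<in> C"
      using that by (auto simp: vector_cut_def)
    then have "(v - s *\<^sub>R e) + (s *\<^sub>R e - v) \<in> C"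
      by (rule blunt_coneD[OF C])
    then show False
      using blunt_coneD(1)[OF C] by simp
  qed
  show ?thesis
    using *[of r r'] *[of r' r] assms by (meson linorder_neqE)
qed

text \<open>The cut value is the supremum of the \<open>s\<close> with
  \<open>v - s *\<^sub>R e\<close> positive. The order unit property, applied to \<open>v\<close>
  and to \<open>- v\<close>, makes this set nonempty and bounded above; totality yields the upper
  half of the cut.\<close>

lemma vector_cut_ex:
  assumes C: "blunt_cone C" and total: "\<And>v. v \<noteq> 0 \<Longrightarrow> v \<in> C \<or> - v \<in> C"
    and e: "e \<in> C" and unit: "\<And>v. \<exists>s. v + s *\<^sub>R e \<in> C"
  shows "\<exists>r. vector_cut C e v r"
proof -
  define S where "S = {s. v - s *\<^sub>R e \<in> C}"
  have down: "x - s *\<^sub>R e \<in> C" if "x - t *\<^sub>R e \<in> C" "s < t" for x s t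
  proof -
    have "(x - t *\<^sub>R e) + (t - s) *\<^sub>R e \<in> C"
      using that e by (intro blunt_coneD[OF C]) auto
    then show ?thesis
      by (simp add: algebra_simps)
  qed
  obtain s0 where "v + s0 *\<^sub>R e \<in> C"
    using unit by blast
  then have "- s0 \<in> S"
    by (simp add: S_def)
  then have nonempty: "S \<noteq> {}"
    by blast
  obtain s1 where s1: "- v + s1 *\<^sub>R e \<in> C"
    using unit by blast
  have "s \<le> s1" if "s \<in> S" for s
  proof (rule ccontr)
    assume "\<not> s \<le> s1"
    then have "v - s1 *\<^sub>R e \<in> C"
      using that by (intro down[of v s s1]) (simp_all add: S_def)
    then have "(v - s1 *\<^sub>R e) + (- v + s1 *\<^sub>R e) \<in> C"
      using s1 by (rule blunt_coneD[OF C])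
    then show False
      using blunt_coneD(1)[OF C] by simp
  qed
  then have bdd: "bdd_above S"
    by (rule bdd_aboveI)
  have "v - s *\<^sub>R e \<in> C" if "s < Sup S" for s
  proof -
    from that obtain t where "t \<in> S" "s < t"
      using less_cSup_iff[OF nonempty bdd] by blast
    then have "v - t *\<^sub>R e \<in> C"
      by (simp add: S_def)
    then show ?thesis
      using \<open>s < t\<close> by (rule down)
  qed
  moreover have "s *\<^sub>R e - v \<in> C" if "s > Sup S" for s
  proof -
    \<comment> \<open>Totality at \<open>t\<close> only gives a positive or zero vector; the gap
      between \<open>t\<close> and \<open>s\<close> then adds a positive multiple of
      \<open>e\<close>, which makes the result strictly positive.\<close>
    from that obtain t where t: "Sup S < t" "t < s"
      using dense by blast
    then have "t \<notin> S"
      using cSup_upper[OF _ bdd] by force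
    then have "t *\<^sub>R e - v \<in> insert 0 C"
      using total[of "v - t *\<^sub>R e"] by (auto simp: S_def)
    moreover have "(s - t) *\<^sub>R e \<in> C"
      using t e by (intro blunt_coneD[OF C]) auto
    moreover have "s *\<^sub>R e - v = (t *\<^sub>R e - v) + (s - t) *\<^sub>R e"
      by (simp add: algebra_simps)
    ultimately show ?thesis
      using blunt_coneD(2)[OF C] by (metis add_0 insertE)
  qed
  ultimately show ?thesis
    by (auto simp: vector_cut_def)
qed

lemma vector_cut_add:
  assumes C: "blunt_cone C" and "vector_cut C e v p" "vector_cut C e w q"
  shows "vector_cut C e (v + w) (p + q)"
proof -
  have "(v + w) - s *\<^sub>R e \<in> C" if "s < p + q" for s
  proof -
    \<comment> \<open>Half of the slack goes to each summand, so that \<open>p - ?d\<close> and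
      \<open>q - ?d\<close> lie strictly below their cut values and add up to \<open>s\<close>. The
      upper half below is symmetric.\<close>
    let ?d = "(p + q - s) / 2"
    have "v - (p - ?d) *\<^sub>R e \<in> C" "w - (q - ?d) *\<^sub>R e \<in> C"
      using assms that by (auto simp: vector_cut_def)
    then have "(v - (p - ?d) *\<^sub>R e) + (w - (q - ?d) *\<^sub>R e) \<in> C"
      by (rule blunt_coneD[OF C])
    moreover have "s *\<^sub>R e = (p - ?d) *\<^sub>R e + (q - ?d) *\<^sub>R e"
      unfolding scaleR_add_left[symmetric] by (rule arg_cong[where f = "\<lambda>c. c *\<^sub>R e"]) argo
    ultimately show ?thesis
      by (simp only: add_diff_add)
  qed
  moreover have "s *\<^sub>R e - (v + w) \<in> C" if "s > p + q" for s
  proof -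
    let ?d = "(s - p - q) / 2"
    have "(p + ?d) *\<^sub>R e - v \<in> C" "(q + ?d) *\<^sub>R e - w \<in> C"
      using assms that by (auto simp: vector_cut_def)
    then have "((p + ?d) *\<^sub>R e - v) + ((q + ?d) *\<^sub>R e - w) \<in> C"
      by (rule blunt_coneD[OF C])
    moreover have "s *\<^sub>R e = (p + ?d) *\<^sub>R e + (q + ?d) *\<^sub>R e"
      unfolding scaleR_add_left[symmetric] by (rule arg_cong[where f = "\<lambda>c. c *\<^sub>R e"]) argo
    ultimately show ?thesis
      by (simp only: add_diff_add)
  qed
  ultimately show ?thesis
    by (simp add: vector_cut_def)
qed

lemma vector_cut_minus:
  assumes "vector_cut C e v r"
  shows "vector_cut C e (- v) (- r)"
proof -
  have "- v - s *\<^sub>R e \<in> C" if "s < - r" for s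
  proof -
    have "(- s) *\<^sub>R e - v \<in> C"
      using assms that unfolding vector_cut_def by (metis less_minus_iff)
    then show ?thesis
      by (simp add: minus_diff_commute[of v])
  qed
  moreover have "s *\<^sub>R e - (- v) \<in> C" if "s > - r" for s
  proof -
    have "v - (- s) *\<^sub>R e \<in> C"
      using assms that unfolding vector_cut_def by (metis minus_less_iff)
    then show ?thesis
      by (simp add: algebra_simps)
  qed
  ultimately show ?thesis
    by (simp add: vector_cut_def)
qed

lemma vector_cut_multiple_unit:
  assumes C: "blunt_cone C" and "e \<in> C"
  shows "vector_cut C e (c *\<^sub>R e) c"
  using assms by (simp add: vector_cut_def blunt_coneD(3) flip: scaleR_diff_left)

lemma vector_cut_scaleR_pos:
  assumes C: "blunt_cone C" and cut: "vector_cut C e v r" and c: "c > 0"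
  shows "vector_cut C e (c *\<^sub>R v) (c * r)"
proof -
  have "c *\<^sub>R v - s *\<^sub>R e \<in> C" if "s < c * r" for s
  proof -
    have "v - (s / c) *\<^sub>R e \<in> C"
      using that cut c by (simp add: vector_cut_def field_simps)
    then have "c *\<^sub>R (v - (s / c) *\<^sub>R e) \<in> C"
      using c by (rule blunt_coneD[OF C])
    then show ?thesis
      using c by (simp add: scaleR_diff_right)
  qed
  moreover have "s *\<^sub>R e - c *\<^sub>R v \<in> C" if "s > c * r" for s
  proof -
    have "(s / c) *\<^sub>R e - v \<in> C"
      using that cut c by (simp add: vector_cut_def field_simps)
    then have "c *\<^sub>R ((s / c) *\<^sub>R e - v) \<in> C"
      using c by (rule blunt_coneD[OF C])
    then show ?thesis
      using c by (simp add: scaleR_diff_right)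
  qed
  ultimately show ?thesis
    by (simp add: vector_cut_def)
qed

lemma vector_cut_scaleR:
  assumes C: "blunt_cone C" and e: "e \<in> C" and cut: "vector_cut C e v r"
  shows "vector_cut C e (c *\<^sub>R v) (c * r)"
proof (cases c "0::real" rule: linorder_cases)
  case less
  then show ?thesis
    using vector_cut_minus[OF vector_cut_scaleR_pos[OF C cut, of "- c"]] by simp
next
  case equal
  then show ?thesis
    using vector_cut_multiple_unit[OF C e, of 0] by simp
next
  case greater
  then show ?thesis
    by (rule vector_cut_scaleR_pos[OF C cut])
qed

section \<open>Positive functionals and separation\<close>

text \<open>The functional maps a vector to its cut value in a total extension of \<open>K\<close>.
  Its linearity follows from uniqueness of cuts, since sums and multiples of cut values are again
  cut values.\<close>

lemma blunt_cone_positive_functional: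
  assumes K: "blunt_cone K" and e: "e \<in> K" and unit: "\<And>v. \<exists>s. v + s *\<^sub>R e \<in> K"
  obtains g :: "'a::real_vector \<Rightarrow> real" where "linear g" "g e = 1" "\<And>v. v \<in> K \<Longrightarrow> 0 \<le> g v"
proof -
  obtain C where C: "blunt_cone C" and KC: "K \<subseteq> C"
    and total: "\<And>v. v \<noteq> 0 \<Longrightarrow> v \<in> C \<or> - v \<in> C"
    using blunt_cone_extend_total[OF K] by blast
  have eC: "e \<in> C" and unitC: "\<exists>s. v + s *\<^sub>R e \<in> C" for v
    using e unit KC by blast+
  have "\<forall>v. \<exists>r. vector_cut C e v r"
    using vector_cut_ex[OF C total eC unitC] by blast
  then obtain g where g: "\<And>v. vector_cut C e v (g v)"
    by metis
  have g_eq: "g v = r" if "vector_cut C e v r" for v r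
    using vector_cut_unique[OF C g that] .
  have "linear g"
    by (intro linearI) (auto intro!: g_eq vector_cut_add vector_cut_scaleR C eC g)
  moreover have "g e = 1"
    using g_eq[OF vector_cut_multiple_unit[OF C eC, of 1]] by simp
  moreover have "0 \<le> g v" if "v \<in> K" for v
  proof (rule ccontr)
    assume "\<not> 0 \<le> g v"
    \<comment> \<open>A negative cut value places \<open>s = 0\<close> in the upper half of the cut,
      so \<open>- v\<close> would be positive together with \<open>v\<close>.\<close>
    then have "0 *\<^sub>R e - v \<in> C"
      using g[of v] unfolding vector_cut_def by (meson not_le)
    then have "v + (0 *\<^sub>R e - v) \<in> C"
      using that KC blunt_coneD(2)[OF C] by blast
    then show False
      using blunt_coneD(1)[OF C] by simp
  qed
  ultimately show ?thesis
    by (rule that)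
qed

text \<open>A core point makes \<open>a - x\<^sub>0\<close> an order unit of the cone generated by
  the translated set. A positive functional \<open>g\<close> normalized at this unit is nonnegative
  on the translate, hence \<open>- g\<close> is largest at \<open>x\<^sub>0\<close> and strictly
  smaller at \<open>a\<close>.\<close>

lemma algebraic_core_supporting_functional:
  assumes "convex \<Omega>" and a: "a \<in> algebraic_core \<Omega>" and "x\<^sub>0 \<notin> \<Omega>"
  obtains f :: "'a::real_vector \<Rightarrow> real"
  where "linear f" "f a < f x\<^sub>0" "\<And>x. x \<in> \<Omega> \<Longrightarrow> f x \<le> f x\<^sub>0"
proof -
  let ?K = "{t *\<^sub>R (x - x\<^sub>0) | t x. 0 < t \<and> x \<in> \<Omega>}"
  have K: "blunt_cone ?K"
    using assms by (intro blunt_cone_convex_translate)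
  have inK: "t *\<^sub>R (x - x\<^sub>0) \<in> ?K" if "t > 0" "x \<in> \<Omega>" for t x
    using that by blast
  have a\<Omega>: "a \<in> \<Omega>"
    using a by (simp add: algebraic_core_def)
  have e: "a - x\<^sub>0 \<in> ?K"
    using inK[of 1 a] a\<Omega> by simp
  have unit: "\<exists>s. v + s *\<^sub>R (a - x\<^sub>0) \<in> ?K" for v
  proof -
    obtain \<delta> where \<delta>: "\<delta> > 0" "\<And>t. \<bar>t\<bar> < \<delta> \<Longrightarrow> a + t *\<^sub>R v \<in> \<Omega>"
      using a unfolding algebraic_core_def by blast
    \<comment> \<open>The step \<open>\<delta> / 2\<close> is admissible at the core point, and
      rescaling by \<open>2 / \<delta>\<close> restores coefficient 1 at \<open>v\<close>.\<close>
    then have "a + (\<delta> / 2) *\<^sub>R v \<in> \<Omega>" by simp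
    then have "(2 / \<delta>) *\<^sub>R (a + (\<delta> / 2) *\<^sub>R v - x\<^sub>0) \<in> ?K"
      using \<delta>(1) by (intro inK) auto
    moreover have "(2 / \<delta>) *\<^sub>R (a + (\<delta> / 2) *\<^sub>R v - x\<^sub>0) = v + (2 / \<delta>) *\<^sub>R (a - x\<^sub>0)"
      using \<delta>(1) by (simp add: scaleR_add_right scaleR_diff_right)
    ultimately show ?thesis
      by metis
  qed
  obtain g :: "'a \<Rightarrow> real" where g: "linear g" "g (a - x\<^sub>0) = 1" "\<And>v. v \<in> ?K \<Longrightarrow> 0 \<le> g v"
    using blunt_cone_positive_functional[OF K e unit] by blast
  show ?thesis
  proof
    show "linear (\<lambda>x. - g x)"
      using g(1) by (rule linear_compose_neg)
    show "- g a < - g x\<^sub>0"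
      using g(2) linear_diff[OF g(1)] by simp
    show "- g x \<le> - g x\<^sub>0" if "x \<in> \<Omega>" for x
      using g(3)[OF inK[of 1 x]] that linear_diff[OF g(1)] by simp
  qed
qed

text \<open>From a core point \<open>x\<close> one can move a little in the direction
  \<open>x\<^sub>0 - a\<close>, along which \<open>f\<close> strictly increases, without leaving the
  set; so \<open>f x\<close> lies strictly below the bound.\<close>

lemma less_on_algebraic_core:
  fixes f :: "'a::real_vector \<Rightarrow> real"
  assumes f: "linear f" and le: "\<And>x. x \<in> \<Omega> \<Longrightarrow> f x \<le> f x\<^sub>0"
    and a: "f a < f x\<^sub>0" and x: "x \<in> algebraic_core \<Omega>"
  shows "f x < f x\<^sub>0"
proof -
  have "\<forall>v. \<exists>\<delta>>0. \<forall>t. \<bar>t\<bar> < \<delta> \<longrightarrow> x + t *\<^sub>R v \<in> \<Omega>"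
    using x by (simp add: algebraic_core_def)
  from this[rule_format, of "x\<^sub>0 - a"]
  obtain \<delta> where \<delta>: "\<delta> > 0" "\<And>t. \<bar>t\<bar> < \<delta> \<Longrightarrow> x + t *\<^sub>R (x\<^sub>0 - a) \<in> \<Omega>"
    by auto
  have "f (x + (\<delta> / 2) *\<^sub>R (x\<^sub>0 - a)) \<le> f x\<^sub>0"
    using \<delta>(1) by (intro le \<delta>(2)) simp
  then have "f x + (\<delta> / 2) * (f x\<^sub>0 - f a) \<le> f x\<^sub>0"
    using f by (simp add: linear_add linear_diff linear_scale diff_divide_distrib right_diff_distrib)
  moreover have "(\<delta> / 2) * (f x\<^sub>0 - f a) > 0"
    using \<delta>(1) a by simp
  ultimately show ?thesis
    by linarith
qed

theorem theorem3p3: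
  fixes \<Omega> :: "'a::real_vector set" and x\<^sub>0 :: 'a
  assumes "convex \<Omega>"
    and "algebraic_core \<Omega> \<noteq> {}"
    and "x\<^sub>0 \<notin> \<Omega>"
  shows "properly_separated \<Omega> {x\<^sub>0} \<and>
    (\<Omega> = algebraic_core \<Omega> \<longrightarrow>
      (\<exists>f :: 'a \<Rightarrow> real. linear f \<and> f \<noteq> (\<lambda>x. 0) \<and> (\<forall>x\<in>\<Omega>. f x < f x\<^sub>0)))"
proof -
  obtain a where a: "a \<in> algebraic_core \<Omega>"
    using assms(2) by blast
  then have a\<Omega>: "a \<in> \<Omega>"
    by (simp add: algebraic_core_def)
  obtain f :: "'a \<Rightarrow> real" where f: "linear f" "f a < f x\<^sub>0" "\<And>x. x \<in> \<Omega> \<Longrightarrow> f x \<le> f x\<^sub>0"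
    using algebraic_core_supporting_functional[OF assms(1) a assms(3)] by blast
  have nonzero: "f \<noteq> (\<lambda>x. 0)"
    using f(2) by auto
  have "separates f \<Omega> {x\<^sub>0}"
    using f nonzero by (auto simp: separates_def intro: SUP_least)
  moreover have "(INF x\<in>\<Omega>. ereal (f x)) < (SUP x\<in>{x\<^sub>0}. ereal (f x))"
    using a\<Omega> f(2) by (auto simp: INF_less_iff)
  ultimately have "properly_separated \<Omega> {x\<^sub>0}"
    using a\<Omega> by (auto simp: properly_separated_def)
  moreover have "\<forall>x\<in>\<Omega>. f x < f x\<^sub>0" if "\<Omega> = algebraic_core \<Omega>"
    using less_on_algebraic_core[OF f(1,3,2)] that by blast
  ultimately show ?thesis
    using f(1) nonzero by blast
qed

end
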